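(* Let $f:(0,\infty)\to\mathbb{R}$ be a measurable function. Suppose that for almost every $a>0$ the limit $$F(a)=\lim_{n\to\infty} f(an)$$ (with $n$ ranging over the positive integers) exists, so that the function $F$ is well-defined almost everywhere on $(0,\infty)$. Then $F$ is constant almost everywhere; that is, there is a constant $C\in\mathbb{R}$ such that $F(a)=C$ for almost every $a>0$.
   Context: "Measurable" and "almost every(where)" refer to Lebesgue measure on $(0,\infty)$. Existence of the limit means existence as a (finite) real number. *)

theory Defs
  imports "HOL-Analysis.Analysis"
begin

end

theory Submission
  imports Defs
begin

text \<open>
  The limit function satisfies \<open>F (k a) = F a\<close> for almost every \<open>a\<close> and each positive integer
  \<open>k\<close>, because \<open>n \<mapsto> f (a k n)\<close> is a subsequence of \<open>n \<mapsto> f (a n)\<close>. Multiplication by the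
  positive integers acts ergodically on the half line: if \<open>E\<close> is invariant up to null sets, then
  \<open>h x = |E \<inter> (0, x)|\<close> satisfies \<open>h (k x) = k h x\<close> and is 1-Lipschitz, hence \<open>h x = x h 1\<close>. So
  \<open>E\<close> has constant density \<open>h 1\<close> in every interval, hence in every Borel set; testing this on
  the complement of \<open>E\<close> shows that \<open>E\<close> or its complement is null. Applied to the superlevel
  sets of \<open>F\<close>, this makes \<open>F\<close> constant almost everywhere.
\<close>

lemma AE_lborel_mult:
  fixes c :: real
  assumes "AE x in lborel. P x" and c: "c \<noteq> 0"
  shows "AE x in lborel. P (c * x)"
proof -
  obtain N where N: "{x \<in> space lborel. \<not> P x} \<subseteq> N" "emeasure lborel N = 0" "N \<in> sets lborel"
    using assms(1) by (rule AE_E)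
  then have "AE x in lborel. x \<notin> N"
    by (intro AE_not_in) auto
  then have "AE x in lborel. 0 + c * x \<notin> N"
    using N(3) by (intro AE_borel_affine[OF c]) auto
  then show ?thesis
    by eventually_elim (use N(1) in auto)
qed

lemma emeasure_lborel_vimage_mult:
  fixes c :: real
  assumes [measurable]: "A \<in> sets borel" and c: "c > 0"
  shows "emeasure lborel A = ennreal c * emeasure lborel {x. c * x \<in> A}"
proof -
  have "emeasure lborel A = ennreal \<bar>c\<bar> * (\<integral>\<^sup>+x. indicator A (0 + c * x) \<partial>lborel)"
    using nn_integral_real_affine[of "indicator A" c 0] c by simp
  also have "(\<integral>\<^sup>+x. indicator A (0 + c * x) \<partial>lborel) = (\<integral>\<^sup>+x. indicator {x. c * x \<in> A} x \<partial>lborel)"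
    by (intro nn_integral_cong) (auto simp: indicator_def)
  also have "\<dots> = emeasure lborel {x. c * x \<in> A}"
    by (rule nn_integral_indicator) measurable
  finally show ?thesis
    using c by simp
qed

text \<open>Homogeneity settles \<open>h\<close> at the integers, and \<open>n * x\<close> lies
  within 1 of an integer \<open>m\<close>. The Lipschitz bound then keeps
  \<open>n * \<bar>h x - x * h 1\<bar>\<close> below \<open>1 + \<bar>h 1\<bar>\<close> for every
  positive \<open>n\<close>, which forces the difference to vanish.\<close>

lemma lipschitz_homogeneous_linear:
  fixes h :: "real \<Rightarrow> real"
  assumes lip: "\<And>x y. 0 \<le> x \<Longrightarrow> x \<le> y \<Longrightarrow> \<bar>h y - h x\<bar> \<le> y - x"
    and hom: "\<And>k x. k > 0 \<Longrightarrow> 0 \<le> x \<Longrightarrow> h (real k * x) = real k * h x"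
    and x: "0 \<le> x"
  shows "h x = x * h 1"
proof (rule ccontr)
  assume "h x \<noteq> x * h 1"
  then have pos: "\<bar>h x - x * h 1\<bar> > 0" by simp
  obtain n :: nat where n: "real n * \<bar>h x - x * h 1\<bar> > 1 + \<bar>h 1\<bar>"
    using ex_less_of_nat_mult[OF pos] by blast
  then have n0: "n > 0" by (cases n) auto
  define m where "m = nat \<lfloor>real n * x\<rfloor>"
  have m: "real m \<le> real n * x" "real n * x \<le> real m + 1"
    using x by (auto simp: m_def of_nat_floor)
  \<comment> \<open>The integer \<open>m\<close> is 0 when \<open>n * x < 1\<close>, and
    \<open>hom\<close> speaks only of positive factors.\<close>
  have h0: "h 0 = 0"
    using hom[of 2 0] by simp
  have hm: "h (real m) = real m * h 1"
    using hom[of m 1] h0 by (cases "m = 0") auto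
  have "\<bar>real n * h x - real m * h 1\<bar> \<le> 1"
    using lip[of "real m" "real n * x"] m hom[OF n0 x] hm by auto
  moreover have "\<bar>(real m - real n * x) * h 1\<bar> \<le> 1 * \<bar>h 1\<bar>"
    unfolding abs_mult using m by (intro mult_right_mono) auto
  moreover have "real n * (h x - x * h 1)
      = (real n * h x - real m * h 1) + (real m - real n * x) * h 1"
    by (simp add: algebra_simps)
  ultimately have "\<bar>real n * (h x - x * h 1)\<bar> \<le> 1 + \<bar>h 1\<bar>"
    by linarith
  with n show False
    by (simp add: abs_mult)
qed

lemma nat_dilation_invariant_measure:
  fixes E :: "real set"
  assumes E [measurable]: "E \<in> sets borel"
    and inv: "\<And>k::nat. k > 0 \<Longrightarrow> AE x in lborel. x > 0 \<longrightarrow> (real k * x \<in> E \<longleftrightarrow> x \<in> E)"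
  obtains c where "c \<ge> 0"
    and "\<And>a b. 0 \<le> a \<Longrightarrow> a \<le> b \<Longrightarrow> emeasure lborel (E \<inter> {a<..<b}) = ennreal (c * (b - a))"
proof -
  have fin: "emeasure lborel (E \<inter> {a<..<b}) < \<infinity>" for a b :: real
  proof -
    have "emeasure lborel (E \<inter> {a<..<b}) \<le> emeasure lborel {a..b}"
      by (intro emeasure_mono) auto
    also have "\<dots> < \<infinity>" by (simp add: emeasure_lborel_Icc_eq)
    finally show ?thesis .
  qed
  define h where "h x = measure lborel (E \<inter> {0<..<x})" for x :: real
  have split: "h y - h x = measure lborel (E \<inter> {x<..<y})" if "0 \<le> x" "x \<le> y" for x y
  proof -
    \<comment> \<open>The two sets can differ only at the point \<open>x\<close>.\<close>
    have "emeasure lborel (E \<inter> {0<..<y}) = emeasure lborel ((E \<inter> {0<..<x}) \<union> (E \<inter> {x<..<y}))"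
      by (intro emeasure_eq_AE eventually_mono[OF AE_lborel_singleton[of x]]) (use that in auto)
    then have "h y = measure lborel ((E \<inter> {0<..<x}) \<union> (E \<inter> {x<..<y}))"
      unfolding h_def measure_def by simp
    also have "\<dots> = h x + measure lborel (E \<inter> {x<..<y})"
      unfolding h_def using fin that by (intro measure_Union) (auto simp: less_top)
    finally show ?thesis by simp
  qed
  have lip: "\<bar>h y - h x\<bar> \<le> y - x" if "0 \<le> x" "x \<le> y" for x y
  proof -
    have "measure lborel (E \<inter> {x<..<y}) \<le> measure lborel {x<..<y}"
      using that by (intro measure_mono_fmeasurable) (auto simp: fmeasurable_def)
    then show ?thesis
      using split[OF that] that by simp
  qed
  have hom: "h (real k * x) = real k * h x" if k: "k > 0" for k x
  proof -
    have "emeasure lborel (E \<inter> {0<..<real k * x})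
        = ennreal (real k) * emeasure lborel {y. real k * y \<in> E \<inter> {0<..<real k * x}}"
      using k by (intro emeasure_lborel_vimage_mult) auto
    \<comment> \<open>Invariance enters here: the preimage under the dilation agrees with
      \<open>E \<inter> {0<..<x}\<close> off a null set.\<close>
    also have "emeasure lborel {y. real k * y \<in> E \<inter> {0<..<real k * x}}
        = emeasure lborel (E \<inter> {0<..<x})"
      by (intro emeasure_eq_AE eventually_mono[OF inv[OF k]]) (use k in \<open>auto simp: zero_less_mult_iff\<close>)
    finally show ?thesis
      unfolding h_def measure_def by (simp add: enn2real_mult)
  qed
  have lin: "h x = x * h 1" if "0 \<le> x" for x
    using lipschitz_homogeneous_linear[of h x] lip hom that by blast
  show thesis
  proof (rule that[of "h 1"])
    show "h 1 \<ge> 0" by (simp add: h_def)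
    fix a b :: real assume ab: "0 \<le> a" "a \<le> b"
    have "measure lborel (E \<inter> {a<..<b}) = h 1 * (b - a)"
      using split[OF ab] lin[of a] lin[of b] ab by (simp add: algebra_simps)
    then show "emeasure lborel (E \<inter> {a<..<b}) = ennreal (h 1 * (b - a))"
      using fin[of a b] by (simp add: emeasure_eq_ennreal_measure)
  qed
qed

lemma nat_dilation_ergodic:
  fixes E :: "real set"
  assumes E [measurable]: "E \<in> sets borel"
    and inv: "\<And>k::nat. k > 0 \<Longrightarrow> AE x in lborel. x > 0 \<longrightarrow> (real k * x \<in> E \<longleftrightarrow> x \<in> E)"
  shows "(AE x in lborel. x > 0 \<longrightarrow> x \<notin> E) \<or> (AE x in lborel. x > 0 \<longrightarrow> x \<in> E)"
proof -
  obtain c where c: "c \<ge> 0"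
    and meas: "\<And>a b. 0 \<le> a \<Longrightarrow> a \<le> b \<Longrightarrow>
      emeasure lborel (E \<inter> {a<..<b}) = ennreal (c * (b - a))"
    using nat_dilation_invariant_measure[OF E inv] by blast
  show ?thesis
  proof (cases "c = 0")
    case True
    have "AE x in lborel. \<forall>n. x \<notin> E \<inter> {0<..<real n}"
      unfolding AE_all_countable
      using meas[of 0] True by (intro allI AE_not_in) (auto simp: null_sets_def)
    then have "AE x in lborel. x > 0 \<longrightarrow> x \<notin> E"
      by eventually_elim (use reals_Archimedean2 in auto)
    then show ?thesis ..
  next
    case False
    with c have c: "c > 0" by simp
    \<comment> \<open>On the positive half line, \<open>E\<close> reweighted by \<open>1 / c\<close>
      gives each interval its length. Setting \<open>w\<close> to 1 elsewhere extends this to the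
      whole line, so that uniqueness of Lebesgue measure yields
      \<open>lborel = density lborel w\<close>. Since \<open>w\<close> vanishes on
      \<open>{0<..} - E\<close>, that set is null.\<close>
    define w where "w x = (if x \<le> 0 then 1 else indicator E x / ennreal c)" for x :: real
    have [measurable]: "w \<in> borel_measurable borel"
      unfolding w_def by measurable
    have "lborel = density lborel w"
    proof (rule lborel_eqI)
      fix l u :: real assume lu: "\<And>b. b \<in> Basis \<Longrightarrow> l \<bullet> b \<le> u \<bullet> b"
      then have lu: "l \<le> u" by simp
      \<comment> \<open>Split \<open>{l<..<u}\<close> at 0: the positive part is
        \<open>{a<..<b}\<close>, the negative part \<open>{min 0 l<..<min 0 u}\<close>, and either
        may be empty. Only the point 0 can be lost.\<close>
      define a b where "a = max 0 l" and "b = max 0 u"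
      have ab: "0 \<le> a" "a \<le> b" using lu by (auto simp: a_def b_def)
      have "emeasure (density lborel w) (box l u) = (\<integral>\<^sup>+x. w x * indicator {l<..<u} x \<partial>lborel)"
        by (simp add: emeasure_density box_real)
      also have "\<dots> = (\<integral>\<^sup>+x. indicator {min 0 l<..<min 0 u} x
          + indicator (E \<inter> {a<..<b}) x / ennreal c \<partial>lborel)"
        by (intro nn_integral_cong_AE eventually_mono[OF AE_lborel_singleton[of 0]])
          (auto simp: w_def a_def b_def indicator_def)
      also have "\<dots> = ennreal (min 0 u - min 0 l) + ennreal (c * (b - a)) / ennreal c"
        using lu meas[OF ab] by (simp add: nn_integral_add nn_integral_divide)
      also have "\<dots> = ennreal (min 0 u - min 0 l) + ennreal (b - a)"
        using c ab by (simp add: divide_ennreal)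
      also have "\<dots> = ennreal (u - l)"
      proof -
        have "u - l = (min 0 u - min 0 l) + (b - a)"
          by (auto simp: a_def b_def)
        moreover have "0 \<le> min 0 u - min 0 l" "0 \<le> b - a"
          using lu ab by auto
        ultimately show ?thesis
          by (simp only: ennreal_plus)
      qed
      finally show "emeasure (density lborel w) (box l u) = (\<Prod>b\<in>Basis. (u - l) \<bullet> b)"
        by simp
    qed simp
    then have "emeasure lborel ({0<..} - E) = emeasure (density lborel w) ({0<..} - E)"
      by (rule arg_cong)
    also have "\<dots> = (\<integral>\<^sup>+x. w x * indicator ({0<..} - E) x \<partial>lborel)"
      by (intro emeasure_density) auto
    also have "\<dots> = (\<integral>\<^sup>+x. 0 \<partial>(lborel :: real measure))"
      by (intro nn_integral_cong) (auto simp: w_def indicator_def)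
    finally have "{0<..} - E \<in> null_sets lborel"
      by (auto simp: null_sets_def)
    then have "AE x in lborel. x > 0 \<longrightarrow> x \<in> E"
      by (rule eventually_mono[OF AE_not_in]) auto
    then show ?thesis ..
  qed
qed

text \<open>The constant is the supremum of the levels that \<open>G\<close> exceeds almost
  everywhere. If there are no such levels, or they are unbounded, then \<open>G\<close> would be
  infinite almost everywhere; being real-valued, it leaves only the case that the whole space is
  null, where any constant works.\<close>

lemma AE_const_if_superlevel_dichotomy:
  fixes G :: "'a \<Rightarrow> real"
  assumes dich: "\<And>c. (AE x in M. \<not> c < G x) \<or> (AE x in M. c < G x)"
  shows "\<exists>C. AE x in M. G x = C"
proof -
  define S where "S = {c. AE x in M. c < G x}"
  have down: "c \<in> S" if "d \<in> S" "c \<le> d" for c d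
    using that unfolding S_def by (auto elim: eventually_mono)
  consider "S = {}" | "\<not> bdd_above S" | "S \<noteq> {}" "bdd_above S" by blast
  then show ?thesis
  proof cases
    case 1
    then have "AE x in M. \<forall>n::nat. \<not> - real n < G x"
      unfolding AE_all_countable S_def using dich by blast
    then have "AE x in M. False"
      by eventually_elim (metis minus_less_iff reals_Archimedean2)
    then show ?thesis by (auto elim: eventually_mono)
  next
    case 2
    then have "real n \<in> S" for n
      using down by (meson bdd_above.I linorder_le_cases)
    then have "AE x in M. \<forall>n::nat. real n < G x"
      unfolding AE_all_countable S_def by blast
    then have "AE x in M. False"
      by eventually_elim (metis less_asym reals_Archimedean2)
    then show ?thesis by (auto elim: eventually_mono)
  next
    case 3
    define C where "C = Sup S"
    have "C - 1 / real (Suc n) \<in> S" for n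
    proof -
      have "C - 1 / real (Suc n) < Sup S" by (simp add: C_def)
      then obtain d where "d \<in> S" "C - 1 / real (Suc n) < d"
        using 3 less_cSup_iff by blast
      then show ?thesis using down by auto
    qed
    then have lo: "AE x in M. \<forall>n. C - 1 / real (Suc n) < G x"
      unfolding AE_all_countable S_def by blast
    \<comment> \<open>A level above the supremum is outside \<open>S\<close>, so the dichotomy gives
      the opposite inequality almost everywhere.\<close>
    have "C + 1 / real (Suc n) \<notin> S" for n
      using cSup_upper[OF _ 3(2), of "C + 1 / real (Suc n)"] by (auto simp: C_def)
    then have hi: "AE x in M. \<forall>n. \<not> C + 1 / real (Suc n) < G x"
      unfolding AE_all_countable S_def using dich by blast
    have "AE x in M. G x = C"
      using lo hi
    proof eventually_elim
      case (elim x)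
      show ?case
      proof (rule ccontr)
        assume "G x \<noteq> C"
        then obtain n where "inverse (real (Suc n)) < \<bar>G x - C\<bar>"
          using reals_Archimedean[of "\<bar>G x - C\<bar>"] by auto
        moreover have "C - inverse (real (Suc n)) < G x" "\<not> C + inverse (real (Suc n)) < G x"
          using elim by (simp_all add: inverse_eq_divide)
        ultimately show False by linarith
      qed
    qed
    then show ?thesis ..
  qed
qed

lemma AE_lebesgue_on_iff:
  fixes S :: "'a::euclidean_space set"
  assumes "S \<in> sets lebesgue"
  shows "(AE x in lebesgue_on S. P x) \<longleftrightarrow> (AE x in lborel. x \<in> S \<longrightarrow> P x)"
  using assms by (subst AE_restrict_space_iff) (auto simp: AE_completion_iff)

theorem proposition4p1:
  fixes f F :: "real \<Rightarrow> real"
  assumes "f \<in> borel_measurable (lebesgue_on {0<..})"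
    and "AE a in lebesgue_on {0<..}. (\<lambda>n. f (a * real (Suc n))) \<longlonglongrightarrow> F a"
  shows "\<exists>C. AE a in lebesgue_on {0<..}. F a = C"
proof -
  \<comment> \<open>Extend \<open>f\<close> by zero and pass to a Borel version \<open>g\<close>,
    since the ergodicity lemma is about Borel sets.\<close>
  have "(\<lambda>x. if x \<in> {0<..} then f x else 0) \<in> borel_measurable lebesgue"
    using assms(1) by (rule borel_measurable_if_I) simp
  then obtain g where g [measurable]: "g \<in> borel_measurable borel"
    and fg: "AE x in lborel. (if x \<in> {0<..} then f x else 0) = g x"
    using completion_ex_borel_measurable_real[of _ lborel] by auto
  \<comment> \<open>Dilations pull null sets back to null sets, so outside one countable union of
    null sets \<open>g\<close> matches the extended \<open>f\<close> at all multiples of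
    \<open>a\<close> at once.\<close>
  have "AE a in lborel. \<forall>n. (if real (Suc n) * a \<in> {0<..} then f (real (Suc n) * a) else 0)
      = g (real (Suc n) * a)"
    unfolding AE_all_countable by (intro allI AE_lborel_mult[OF fg]) simp
  moreover have "AE a in lborel. a > 0 \<longrightarrow> (\<lambda>n. f (a * real (Suc n))) \<longlonglongrightarrow> F a"
    using assms(2) by (simp add: AE_lebesgue_on_iff)
  ultimately have conv: "AE a in lborel. a > 0 \<longrightarrow> (\<lambda>n. g (real (Suc n) * a)) \<longlonglongrightarrow> F a"
  proof eventually_elim
    case (elim a)
    show ?case
    proof
      assume "a > 0"
      then have "f (a * real (Suc n)) = g (real (Suc n) * a)" for n
        using elim(1)[rule_format, of n] by (simp add: mult.commute zero_less_mult_iff)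
      then show "(\<lambda>n. g (real (Suc n) * a)) \<longlonglongrightarrow> F a"
        using elim(2) \<open>a > 0\<close> by simp
    qed
  qed
  \<comment> \<open>\<open>F\<close> carries no measurability assumption; \<open>G\<close> is a
    Borel function equal to it almost everywhere on the half line. Where the sequence diverges,
    \<open>lim\<close> still returns some value.\<close>
  define G where "G a = lim (\<lambda>n. g (real (Suc n) * a))" for a
  have [measurable]: "G \<in> borel_measurable borel"
    unfolding G_def by (intro borel_measurable_lim_metric) measurable
  have FG: "AE a in lborel. a > 0 \<longrightarrow> F a = G a"
    using conv by eventually_elim (auto simp: G_def limI)
  \<comment> \<open>Convergence at \<open>a\<close> suffices: convergence at \<open>k * a\<close>,
    to the same limit, follows from it.\<close>
  have inv: "AE a in lborel. a > 0 \<longrightarrow> G (real k * a) = G a" if k: "k > 0" for k :: nat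
    using conv
  proof eventually_elim
    case (elim a)
    show ?case
    proof
      assume "a > 0"
      with elim have lim: "(\<lambda>n. g (real (Suc n) * a)) \<longlonglongrightarrow> F a" by simp
      \<comment> \<open>The term for the multiple \<open>j * a\<close> has index
        \<open>j - 1\<close>, so the multiple \<open>Suc n * k\<close> sits at index
        \<open>Suc n * k - 1\<close>.\<close>
      have "strict_mono (\<lambda>n. Suc n * k - 1)"
        using k by (intro strict_mono_Suc_iff[THEN iffD2]) auto
      from LIMSEQ_subseq_LIMSEQ[OF lim this]
      have "(\<lambda>n. g (real (Suc (Suc n * k - 1)) * a)) \<longlonglongrightarrow> F a"
        by (simp add: o_def)
      moreover have "real (Suc (Suc n * k - 1)) * a = real (Suc n) * (real k * a)" for n
        using k by (simp add: of_nat_diff algebra_simps)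
      ultimately have "(\<lambda>n. g (real (Suc n) * (real k * a))) \<longlonglongrightarrow> F a"
        by (simp only:)
      then show "G (real k * a) = G a"
        using lim by (simp add: G_def limI)
    qed
  qed
  have "(AE a in lebesgue_on {0<..}. \<not> c < G a) \<or> (AE a in lebesgue_on {0<..}. c < G a)" for c
  proof -
    have "(AE x in lborel. x > 0 \<longrightarrow> x \<notin> {x. c < G x}) \<or> (AE x in lborel. x > 0 \<longrightarrow> x \<in> {x. c < G x})"
    proof (rule nat_dilation_ergodic)
      show "AE x in lborel. x > 0 \<longrightarrow> (real k * x \<in> {x. c < G x} \<longleftrightarrow> x \<in> {x. c < G x})"
        if "k > 0" for k
        using inv[OF that] by eventually_elim auto
    qed measurable
    then show ?thesis
      by (simp add: AE_lebesgue_on_iff)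
  qed
  then obtain C where "AE a in lebesgue_on {0<..}. G a = C"
    using AE_const_if_superlevel_dichotomy by blast
  moreover have "AE a in lebesgue_on {0<..}. F a = G a"
    using FG by (simp add: AE_lebesgue_on_iff)
  ultimately have "AE a in lebesgue_on {0<..}. F a = C"
    by eventually_elim simp
  then show ?thesis ..
qed

end
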